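(* The following hold. (1) For each $a\in\{1,\dots,D\}$ the wave matrices $W=W_1$ and $W=W_2$ are solutions of the linear system $T_aW=\omega_aW$. (2) The Jacobi type matrices satisfy the discrete Lax equations $$T_b(n_a\cdot J)\,\omega_b=\omega_b\,(n_a\cdot J),\qquad M_b\,T_b(n_a\cdot J)=(n_a\cdot J)\,M_b,\qquad\forall a,b\in\{1,\dots,D\}.$$ (3) The lattice resolvents $\omega_a$ and the matrices $M_a$ satisfy the discrete Zakharov–Shabat equations $$(T_a\omega_b)\,\omega_a=(T_b\omega_a)\,\omega_b,\qquad M_a\,(T_aM_b)=M_b\,(T_bM_a),\qquad\forall a,b\in\{1,\dots,D\}.$$
   Context: Let $D\ge 1$. For $k\in\mathbb Z_+$ let $[k]=\{\alpha\in\mathbb Z_+^D:|\alpha|=k\}$, ordered so that $\alpha>\alpha'$ iff at the first coordinate where they differ the entry of $\alpha$ is smaller. $\chi_{[k]}(x)$ is the column vector of monomials $x^\alpha$, $\alpha\in[k]$, and $\chi$ stacks $\chi_{[0]},\chi_{[1]},\dots$. Semi-infinite matrices are partitioned in blocks $A_{[k],[\ell]}\in\mathbb R^{|[k]|\times|[\ell]|}$. Shift matrices: $\Lambda_b$ has as only nonzero blocks $(\Lambda_b)_{[k],[k+1]}$, with entries $\delta_{\alpha+e_b,\alpha'}$, $\alpha\in[k]$, $\alpha'\in[k+1]$; $n\cdot\Lambda=\sum_bn_b\Lambda_b$. Discrete flows: fix an invertible $N=(n_{a,b})\in GL(\mathbb R^D)$, $n_a=(n_{a,1},\dots,n_{a,D})^\top$,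 and $q\in\mathbb R^D$ with all $q_a\ne0$. Let $\mu$ be a Borel measure with finite moments and support in $\{x:|n_a\cdot x|<|q_a|,\ a=1,\dots,D\}$. For $m\in\mathbb Z^D$, $d\mu_m(x)=\big[\prod_a(n_a\cdot x-q_a)^{m_a}\big]d\mu(x)$ has moment matrix $G(m)=\int\chi\,d\mu_m\,\chi^\top$, and it is assumed that for each $m$, $G(m)=S(m)^{-1}H(m)(S(m)^{-1})^\top$ with $S(m)$ block lower triangular with identity diagonal blocks and $H(m)$ block diagonal with invertible blocks. $(T_af)(m)=f(m+e_a)$; the dependence on $m$ is omitted. $W_0(m)=\prod_{a=1}^D(n_a\cdot\Lambda-q_a)^{m_a}$ (block upper triangular; inverses exist as block upper triangular matrices since $q_a\neq0$). Wave matrices: $W_1=SW_0$, $W_2=H(S^{-1})^\top$. Jacobi type matrices: $J_b=S\Lambda_bS^{-1}$, $n\cdot J=\sum_bn_bJ_b$. $M_a=S(T_aS)^{-1}$. Lattice resolvent: $\omega_a=(T_aH)M_a^\top H^{-1}$. *)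

theory Defs
  imports "HOL-Analysis.Analysis"
begin

text \<open>The coordinates \<open>1, \<dots>, D\<close> are the elements of a finite linearly ordered type. Rows and columns
  of semi-infinite matrices are labelled by the multi-indices themselves; the block \<open>([k],[l])\<close>
  consists of the entries whose row label has degree \<open>k\<close> and whose column label has degree \<open>l\<close>. The
  order of the labels within a block only fixes how a matrix is displayed and plays no role.\<close>

type_synonym 'd mi = "nat ^ 'd"

type_synonym 'd smat = "'d mi \<Rightarrow> 'd mi \<Rightarrow> real"

type_synonym 'd rvec = "real ^ 'd"

type_synonym 'd rmat = "real ^ 'd ^ 'd"

type_synonym 'd zvec = "int ^ 'd"

definition mdeg :: "'d::finite mi \<Rightarrow> nat" where
  "mdeg \<alpha> = (\<Sum>b\<in>UNIV. \<alpha> $ b)"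

definition level :: "nat \<Rightarrow> 'd::finite mi set" where
  "level k = {\<alpha>. mdeg \<alpha> = k}"

definition monomial :: "'d::finite mi \<Rightarrow> 'd rvec \<Rightarrow> real" where
  "monomial \<alpha> x = (\<Prod>b\<in>UNIV. (x $ b) ^ (\<alpha> $ b))"

text \<open>The unconditional sum is 0 when it diverges. In all products formed below only finitely many
  terms are nonzero; for a resolvent times another matrix this is because the resolvent equals
  \<open>(T\<^sub>a S)(n\<^sub>a \<cdot> \<Lambda> - q\<^sub>a)S\<^sup>-\<^sup>1\<close> and hence has rows of finite support.\<close>

definition smult_mat :: "'d::finite smat \<Rightarrow> 'd smat \<Rightarrow> 'd smat" (infixl "\<star>" 70) where
  "A \<star> B = (\<lambda>\<alpha> \<beta>. \<Sum>\<^sub>\<infinity>\<gamma>\<in>UNIV. A \<alpha> \<gamma> * B \<gamma> \<beta>)"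

definition sid :: "'d::finite smat" where
  "sid = (\<lambda>\<alpha> \<beta>. if \<alpha> = \<beta> then 1 else 0)"

definition stransp :: "'d::finite smat \<Rightarrow> 'd smat" where
  "stransp A = (\<lambda>\<alpha> \<beta>. A \<beta> \<alpha>)"

definition block_lower :: "'d::finite smat \<Rightarrow> bool" where
  "block_lower A \<longleftrightarrow> (\<forall>\<alpha> \<beta>. mdeg \<alpha> < mdeg \<beta> \<longrightarrow> A \<alpha> \<beta> = 0)"

definition block_upper :: "'d::finite smat \<Rightarrow> bool" where
  "block_upper A \<longleftrightarrow> (\<forall>\<alpha> \<beta>. mdeg \<beta> < mdeg \<alpha> \<longrightarrow> A \<alpha> \<beta> = 0)"

definition block_diag :: "'d::finite smat \<Rightarrow> bool" where
  "block_diag A \<longleftrightarrow> (\<forall>\<alpha> \<beta>. mdeg \<alpha> \<noteq> mdeg \<beta> \<longrightarrow> A \<alpha> \<beta> = 0)"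

definition id_diag_blocks :: "'d::finite smat \<Rightarrow> bool" where
  "id_diag_blocks A \<longleftrightarrow> (\<forall>k. \<forall>\<alpha>\<in>level k. \<forall>\<beta>\<in>level k. A \<alpha> \<beta> = (if \<alpha> = \<beta> then 1 else 0))"

definition invertible_diag_blocks :: "'d::finite smat \<Rightarrow> bool" where
  "invertible_diag_blocks A \<longleftrightarrow> (\<forall>k. \<exists>B :: 'd smat. \<forall>\<alpha>\<in>level k. \<forall>\<beta>\<in>level k.
     (\<Sum>\<gamma>\<in>level k. A \<alpha> \<gamma> * B \<gamma> \<beta>) = (if \<alpha> = \<beta> then 1 else 0) \<and>
     (\<Sum>\<gamma>\<in>level k. B \<alpha> \<gamma> * A \<gamma> \<beta>) = (if \<alpha> = \<beta> then 1 else 0))"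

text \<open>A semi-infinite matrix may have several two-sided inverses, so an inverse is always taken within
  a class \<open>P\<close> of block matrices (lower triangular, upper triangular, diagonal), where it is unique.\<close>

definition inv_in :: "('d::finite smat \<Rightarrow> bool) \<Rightarrow> 'd smat \<Rightarrow> 'd smat" where
  "inv_in P A = (THE B. P B \<and> A \<star> B = sid \<and> B \<star> A = sid)"

definition spow :: "'d::finite smat \<Rightarrow> nat \<Rightarrow> 'd smat" where
  "spow A k = ((\<lambda>B. A \<star> B) ^^ k) sid"

definition upper_powi :: "'d::finite smat \<Rightarrow> int \<Rightarrow> 'd smat" where
  "upper_powi A k =
     (if 0 \<le> k then spow A (nat k) else spow (inv_in block_upper A) (nat (- k)))"

definition Lam :: "'d::finite \<Rightarrow> 'd smat" where
  "Lam b = (\<lambda>\<alpha> \<alpha>'. if \<alpha> + axis b 1 = \<alpha>' then 1 else 0)"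

text \<open>The linear combination \<open>v\<^sub>1 A\<^sub>1 + \<dots> + v\<^sub>D A\<^sub>D\<close>, written \<open>v \<cdot> A\<close> on paper.\<close>

definition dotmat :: "'d::finite rvec \<Rightarrow> ('d \<Rightarrow> 'd smat) \<Rightarrow> 'd smat" where
  "dotmat v A = (\<lambda>\<alpha> \<beta>. \<Sum>b\<in>UNIV. v $ b * A b \<alpha> \<beta>)"

definition msupport :: "('d::finite rvec) measure \<Rightarrow> ('d rvec) set" where
  "msupport \<mu> = {x. \<forall>U. open U \<and> x \<in> U \<longrightarrow> emeasure \<mu> U \<noteq> 0}"

text \<open>The measure \<open>\<mu>\<^sub>m\<close> may be negative, so integration against it is written as integration of the
  density against \<open>\<mu>\<close>.\<close>

definition weight :: "'d::finite rmat \<Rightarrow> 'd rvec \<Rightarrow> 'd zvec \<Rightarrow> 'd rvec \<Rightarrow> real" where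
  "weight N q m x = (\<Prod>a\<in>UNIV. (N $ a \<bullet> x - q $ a) powi (m $ a))"

definition moment_matrix ::
  "'d::finite rmat \<Rightarrow> 'd rvec \<Rightarrow> ('d rvec) measure \<Rightarrow> 'd zvec \<Rightarrow> 'd smat" where
  "moment_matrix N q \<mu> m =
     (\<lambda>\<alpha> \<beta>. \<integral>x. monomial \<alpha> x * weight N q m x * monomial \<beta> x \<partial>\<mu>)"

definition shift :: "'d::finite \<Rightarrow> ('d zvec \<Rightarrow> 'b) \<Rightarrow> 'd zvec \<Rightarrow> 'b" where
  "shift a f = (\<lambda>m. f (m + axis a 1))"

text \<open>The factors of \<open>W\<^sub>0\<close> commute; the product is taken in increasing order of the index.\<close>

definition W0 :: "'d::{finite,linorder} rmat \<Rightarrow> 'd rvec \<Rightarrow> 'd zvec \<Rightarrow> 'd smat" where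
  "W0 N q m = foldr
     (\<lambda>a B. upper_powi (\<lambda>\<alpha> \<beta>. dotmat (N $ a) Lam \<alpha> \<beta> - q $ a * sid \<alpha> \<beta>) (m $ a) \<star> B)
     (sorted_list_of_set UNIV) sid"

definition W1 :: "'d::{finite,linorder} rmat \<Rightarrow> 'd rvec \<Rightarrow> ('d zvec \<Rightarrow> 'd smat) \<Rightarrow>
    'd zvec \<Rightarrow> 'd smat" where
  "W1 N q S m = S m \<star> W0 N q m"

definition W2 :: "('d::finite zvec \<Rightarrow> 'd smat) \<Rightarrow> ('d zvec \<Rightarrow> 'd smat) \<Rightarrow> 'd zvec \<Rightarrow> 'd smat" where
  "W2 S H m = H m \<star> stransp (inv_in block_lower (S m))"

definition Jac :: "('d::finite zvec \<Rightarrow> 'd smat) \<Rightarrow> 'd \<Rightarrow> 'd zvec \<Rightarrow> 'd smat" where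
  "Jac S b m = S m \<star> Lam b \<star> inv_in block_lower (S m)"

definition nJ :: "'d::finite rvec \<Rightarrow> ('d zvec \<Rightarrow> 'd smat) \<Rightarrow> 'd zvec \<Rightarrow> 'd smat" where
  "nJ v S m = dotmat v (\<lambda>b. Jac S b m)"

definition Mmat :: "('d::finite zvec \<Rightarrow> 'd smat) \<Rightarrow> 'd \<Rightarrow> 'd zvec \<Rightarrow> 'd smat" where
  "Mmat S a m = S m \<star> inv_in block_lower (shift a S m)"

definition resolvent :: "('d::finite zvec \<Rightarrow> 'd smat) \<Rightarrow> ('d zvec \<Rightarrow> 'd smat) \<Rightarrow>
    'd \<Rightarrow> 'd zvec \<Rightarrow> 'd smat" where
  "resolvent S H a m =
     shift a H m \<star> stransp (Mmat S a m) \<star> inv_in block_diag (H m)"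

end

theory Submission
  imports Defs
begin

text \<open>Multiplying the measure by \<open>n\<^sub>a \<cdot> x - q\<^sub>a\<close> multiplies the moment matrix from the left:
  \<open>T\<^sub>a G = (n\<^sub>a \<cdot> \<Lambda> - q\<^sub>a) G\<close>. Inserting the Gauss-Borel factorization \<open>G = S\<^sup>-\<^sup>1 H S\<^sup>-\<^sup>T\<close> on both sides
  gives a second expression for the resolvent, \<open>\<omega>\<^sub>a = (T\<^sub>a S)(n\<^sub>a \<cdot> \<Lambda> - q\<^sub>a)S\<^sup>-\<^sup>1\<close>. With this one the
  equation for \<open>W\<^sub>1\<close>, the Lax equations and the Zakharov-Shabat equations follow by cancelling \<open>S\<close>
  against its inverse and commuting the operators \<open>n\<^sub>a \<cdot> \<Lambda> - q\<^sub>a\<close>; the original expression gives the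
  equation for \<open>W\<^sub>2\<close>.

  Products of semi-infinite matrices are not associative in general. They are when the two left
  factors have finite rows, or the two right factors finite columns, and every rebracketing
  below is of one of these two kinds.\<close>

subsection \<open>Row- and column-finite matrices\<close>

text \<open>Each coordinate is bounded by the degree. The finite rows and columns of block
  triangular matrices come from this.\<close>

lemma finite_mdeg_le: "finite {\<delta> :: 'd::finite mi. mdeg \<delta> \<le> k}"
proof (rule finite_subset)
  show "{\<delta> :: 'd mi. mdeg \<delta> \<le> k} \<subseteq> vec_lambda ` (UNIV \<rightarrow>\<^sub>E {..k})"
  proof
    fix \<delta> :: "'d mi" assume "\<delta> \<in> {\<delta>. mdeg \<delta> \<le> k}"
    then have "(\<Sum>b\<in>UNIV. \<delta> $ b) \<le> k" by (simp add: mdeg_def)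
    moreover have "\<delta> $ b \<le> (\<Sum>b\<in>UNIV. \<delta> $ b)" for b by (rule member_le_sum) auto
    ultimately have "vec_nth \<delta> \<in> UNIV \<rightarrow>\<^sub>E {..k}" by (auto intro: order_trans)
    then show "\<delta> \<in> vec_lambda ` (UNIV \<rightarrow>\<^sub>E {..k})" by (metis image_eqI vec_nth_inverse)
  qed
qed (simp add: finite_PiE)

lemma finite_mdeg_less: "finite {\<delta> :: 'd::finite mi. mdeg \<delta> < k}"
  by (rule finite_subset[OF _ finite_mdeg_le[of k]]) auto

lemma finite_level: "finite (level k :: 'd::finite mi set)"
  by (rule finite_subset[OF _ finite_mdeg_le[of k]]) (auto simp: level_def)

lemma mdeg_axis [simp]: "mdeg (\<alpha> + axis b n) = mdeg \<alpha> + n"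
  by (simp add: mdeg_def axis_def sum.distrib)

definition rowfin :: "'d::finite smat \<Rightarrow> bool" where
  "rowfin A \<longleftrightarrow> (\<forall>\<alpha>. finite {\<beta>. A \<alpha> \<beta> \<noteq> 0})"

text \<open>Phrased through the transpose, so that \<open>stransp_star\<close> carries facts about
  rows over to columns.\<close>

definition colfin :: "'d::finite smat \<Rightarrow> bool" where
  "colfin A \<longleftrightarrow> rowfin (stransp A)"

lemma rowfin_subset: "(\<And>\<alpha>. finite (F \<alpha>)) \<Longrightarrow> (\<And>\<alpha> \<beta>. A \<alpha> \<beta> \<noteq> 0 \<Longrightarrow> \<beta> \<in> F \<alpha>) \<Longrightarrow> rowfin A"
  unfolding rowfin_def by (metis (mono_tags, lifting) finite_subset mem_Collect_eq subsetI)

text \<open>\<open>F\<close> may exceed the support of the summand, which allows several products to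
  be summed over one common set.\<close>

lemma star_eq_sum:
  assumes "finite F" "\<And>\<gamma>. \<gamma> \<notin> F \<Longrightarrow> A \<alpha> \<gamma> * B \<gamma> \<beta> = 0"
  shows "(A \<star> B) \<alpha> \<beta> = (\<Sum>\<gamma>\<in>F. A \<alpha> \<gamma> * B \<gamma> \<beta>)"
proof -
  have "(A \<star> B) \<alpha> \<beta> = (\<Sum>\<^sub>\<infinity>\<gamma>\<in>F. A \<alpha> \<gamma> * B \<gamma> \<beta>)"
    unfolding smult_mat_def by (rule infsum_cong_neutral) (use assms in auto)
  then show ?thesis using assms by simp
qed

lemma star_rowfin:
  "rowfin A \<Longrightarrow> (A \<star> B) \<alpha> \<beta> = (\<Sum>\<gamma> | A \<alpha> \<gamma> \<noteq> 0. A \<alpha> \<gamma> * B \<gamma> \<beta>)"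
  by (rule star_eq_sum) (auto simp: rowfin_def)

lemma stransp_stransp [simp]: "stransp (stransp A) = A"
  by (simp add: stransp_def)

lemma stransp_star: "stransp (A \<star> B) = stransp B \<star> stransp A"
  by (simp add: stransp_def smult_mat_def mult.commute)

lemma stransp_sid [simp]: "stransp sid = sid"
  by (auto simp: stransp_def sid_def intro!: ext)

lemma sum_sid [simp]:
  assumes "finite F"
  shows "(\<Sum>\<gamma>\<in>F. f \<gamma> * sid \<gamma> \<beta>) = (if \<beta> \<in> F then f \<beta> else 0)"
    and "(\<Sum>\<gamma>\<in>F. sid \<alpha> \<gamma> * f \<gamma>) = (if \<alpha> \<in> F then f \<alpha> else 0)"
  using assms by (simp_all add: sid_def if_distrib[of "(*) _"] if_distrib[of "\<lambda>x. x * _"] cong: if_cong)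

lemma rowfin_sid [simp]: "rowfin sid"
  by (simp add: rowfin_def sid_def)

lemma colfin_sid [simp]: "colfin sid"
  by (simp add: colfin_def)

lemma colfin_stransp [simp]: "colfin (stransp A) = rowfin A"
  by (simp add: colfin_def)

lemma rowfin_star [simp]:
  assumes "rowfin A" "rowfin B"
  shows "rowfin (A \<star> B)"
proof (rule rowfin_subset)
  fix \<alpha> \<beta>
  show "finite (\<Union>\<gamma>\<in>{\<gamma>. A \<alpha> \<gamma> \<noteq> 0}. {\<beta>. B \<gamma> \<beta> \<noteq> 0})"
    using assms by (auto simp: rowfin_def)
  assume "(A \<star> B) \<alpha> \<beta> \<noteq> 0"
  then obtain \<gamma> where "A \<alpha> \<gamma> * B \<gamma> \<beta> \<noteq> 0"
    unfolding star_rowfin[OF assms(1)] by (meson sum.neutral)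
  then show "\<beta> \<in> (\<Union>\<gamma>\<in>{\<gamma>. A \<alpha> \<gamma> \<noteq> 0}. {\<beta>. B \<gamma> \<beta> \<noteq> 0})" by auto
qed

lemma colfin_star [simp]: "colfin A \<Longrightarrow> colfin B \<Longrightarrow> colfin (A \<star> B)"
  by (simp add: colfin_def stransp_star)

text \<open>A fixed row of \<open>A\<close> meets finitely many \<gamma>, and each such row of
  \<open>B\<close> finitely many \<delta>, so the double sum is finite and can be swapped.
  \<open>C\<close> is arbitrary.\<close>

lemma star_assoc_rowfin:
  assumes A: "rowfin A" and B: "rowfin B"
  shows "(A \<star> B) \<star> C = A \<star> (B \<star> C)"
proof (intro ext)
  fix \<alpha> \<beta>
  let ?F = "{\<gamma>. A \<alpha> \<gamma> \<noteq> 0}"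
  define G where "G = (\<Union>\<gamma>\<in>?F. {\<delta>. B \<gamma> \<delta> \<noteq> 0})"
  have G: "finite G" using A B by (auto simp: G_def rowfin_def)
  have AB: "(A \<star> B) \<alpha> \<delta> = 0" if "\<delta> \<notin> G" for \<delta>
    unfolding star_rowfin[OF A] using that by (intro sum.neutral) (auto simp: G_def)
  have "((A \<star> B) \<star> C) \<alpha> \<beta> = (\<Sum>\<delta>\<in>G. (\<Sum>\<gamma>\<in>?F. A \<alpha> \<gamma> * B \<gamma> \<delta>) * C \<delta> \<beta>)"
    unfolding star_rowfin[OF A, symmetric] by (rule star_eq_sum[OF G]) (simp add: AB)
  also have "\<dots> = (\<Sum>\<gamma>\<in>?F. \<Sum>\<delta>\<in>G. A \<alpha> \<gamma> * B \<gamma> \<delta> * C \<delta> \<beta>)"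
    unfolding sum_distrib_right by (rule sum.swap)
  also have "\<dots> = (\<Sum>\<gamma>\<in>?F. A \<alpha> \<gamma> * (B \<star> C) \<gamma> \<beta>)"
  proof (rule sum.cong[OF refl])
    fix \<gamma> assume "\<gamma> \<in> ?F"
    then have "(B \<star> C) \<gamma> \<beta> = (\<Sum>\<delta>\<in>G. B \<gamma> \<delta> * C \<delta> \<beta>)"
      by (intro star_eq_sum[OF G]) (auto simp: G_def)
    then show "(\<Sum>\<delta>\<in>G. A \<alpha> \<gamma> * B \<gamma> \<delta> * C \<delta> \<beta>) = A \<alpha> \<gamma> * (B \<star> C) \<gamma> \<beta>"
      by (simp add: sum_distrib_left mult.assoc)
  qed
  finally show "((A \<star> B) \<star> C) \<alpha> \<beta> = (A \<star> (B \<star> C)) \<alpha> \<beta>"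
    by (simp add: star_rowfin[OF A])
qed

text \<open>The transpose of \<open>star_assoc_rowfin\<close>; now the leftmost factor is
  arbitrary.\<close>

lemma star_assoc_colfin:
  assumes "colfin B" "colfin C"
  shows "(A \<star> B) \<star> C = A \<star> (B \<star> C)"
proof -
  have "stransp ((A \<star> B) \<star> C) = stransp (A \<star> (B \<star> C))"
    using assms by (simp add: stransp_star colfin_def star_assoc_rowfin)
  then show ?thesis by (metis stransp_stransp)
qed

lemma star_sid [simp]: "A \<star> sid = A" "sid \<star> A = A"
proof -
  show *: "sid \<star> A = A" for A :: "'d::finite smat"
    by (intro ext, subst star_eq_sum[of "{_}"]) (auto simp: sid_def)
  show "A \<star> sid = A"
    using *[of "stransp A"] by (metis stransp_star stransp_stransp stransp_sid)
qed

lemma rowfin_lower: "block_lower A \<Longrightarrow> rowfin A"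
  by (rule rowfin_subset[of "\<lambda>\<alpha>. {\<beta>. mdeg \<beta> \<le> mdeg \<alpha>}"])
    (use finite_mdeg_le in \<open>auto simp: block_lower_def intro: leI\<close>)

lemma block_upper_stransp: "block_upper (stransp A) = block_lower A"
  by (auto simp: block_upper_def block_lower_def stransp_def)

lemma colfin_upper: "block_upper A \<Longrightarrow> colfin A"
  using block_upper_stransp[of "stransp A"] rowfin_lower by (simp add: colfin_def)

lemma block_diag_lower: "block_diag A \<Longrightarrow> block_lower A"
  and block_diag_upper: "block_diag A \<Longrightarrow> block_upper A"
  by (auto simp: block_diag_def block_lower_def block_upper_def)

subsection \<open>Inverses of block triangular matrices\<close>

text \<open>If \<open>B\<close> and \<open>C\<close> are inverses in \<open>P\<close>, then
  \<open>C = C (A B) = (C A) B = B\<close>. Rebracketing needs \<open>C\<close> and \<open>A\<close>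
  row-finite or \<open>A\<close> and \<open>B\<close> column-finite, hence the two alternatives: the
  first serves lower and diagonal matrices, the second upper ones.\<close>

lemma inv_in_eqI:
  assumes "P B" "A \<star> B = sid" "B \<star> A = sid"
    and fin: "rowfin A \<and> (\<forall>B. P B \<longrightarrow> rowfin B) \<or> colfin A \<and> (\<forall>B. P B \<longrightarrow> colfin B)"
  shows "inv_in P A = B"
  unfolding inv_in_def
proof (rule the_equality)
  fix C assume C: "P C \<and> A \<star> C = sid \<and> C \<star> A = sid"
  have "(C \<star> A) \<star> B = C \<star> (A \<star> B)"
    using fin assms(1) C star_assoc_rowfin star_assoc_colfin by blast
  then show "C = B" using C assms by simp
qed (use assms in auto)

lemma diag_inverse:
  fixes A :: "'d::finite smat"
  assumes A: "block_diag A" and inv: "invertible_diag_blocks A"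
  shows "\<exists>B. block_diag B \<and> A \<star> B = sid \<and> B \<star> A = sid"
proof -
  obtain E where E: "\<And>k \<alpha> \<beta>. \<alpha> \<in> level k \<Longrightarrow> \<beta> \<in> level k \<Longrightarrow>
     (\<Sum>\<gamma>\<in>level k. A \<alpha> \<gamma> * E k \<gamma> \<beta>) = (if \<alpha> = \<beta> then 1 else 0) \<and>
     (\<Sum>\<gamma>\<in>level k. E k \<alpha> \<gamma> * A \<gamma> \<beta>) = (if \<alpha> = \<beta> then 1 else 0)"
    using inv[unfolded invertible_diag_blocks_def choice_iff] by blast
  \<comment> \<open>\<open>E k\<close> inverts block \<open>k\<close> and is uncontrolled elsewhere,
    so only that block of it is kept.\<close>
  define B :: "'d smat" where "B = (\<lambda>\<alpha> \<beta>. if mdeg \<alpha> = mdeg \<beta> then E (mdeg \<alpha>) \<alpha> \<beta> else 0)"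
  have B: "block_diag B" by (simp add: B_def block_diag_def)
  have *: "(X \<star> Y) \<alpha> \<beta> = (\<Sum>\<gamma>\<in>level (mdeg \<alpha>). X \<alpha> \<gamma> * Y \<gamma> \<beta>)"
    if "block_diag X" for X Y :: "'d smat" and \<alpha> \<beta>
    by (rule star_eq_sum[OF finite_level]) (use that in \<open>auto simp: block_diag_def level_def\<close>)
  have "(A \<star> B) \<alpha> \<beta> = sid \<alpha> \<beta> \<and> (B \<star> A) \<alpha> \<beta> = sid \<alpha> \<beta>" for \<alpha> \<beta>
  proof (cases "mdeg \<alpha> = mdeg \<beta>")
    case True
    then have "\<alpha> \<in> level (mdeg \<alpha>)" "\<beta> \<in> level (mdeg \<alpha>)" by (simp_all add: level_def)
    moreover have "B \<gamma> \<delta> = E (mdeg \<alpha>) \<gamma> \<delta>" if "\<gamma> \<in> level (mdeg \<alpha>)" "\<delta> \<in> level (mdeg \<alpha>)" for \<gamma> \<delta>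
      using that by (simp add: B_def level_def)
    ultimately show ?thesis
      using E[of \<alpha> "mdeg \<alpha>" \<beta>] by (simp add: *[OF A] *[OF B] sid_def cong: sum.cong)
  next
    case False
    then show ?thesis using A B
      by (auto simp: *[OF A] *[OF B] sid_def block_diag_def level_def intro!: sum.neutral)
  qed
  then show ?thesis using B by (intro exI[of _ B]) (auto intro!: ext)
qed

text \<open>Forward substitution for \<open>A \<star> B = sid\<close>, one row block at a time: rows
  of smaller degree are known, move to the other side, and \<open>E\<close> inverts the diagonal
  block.\<close>

function lower_rinv :: "'d::finite smat \<Rightarrow> 'd smat \<Rightarrow> 'd smat" where
  "lower_rinv A E \<alpha> \<beta> = (\<Sum>\<gamma>\<in>level (mdeg \<alpha>). E \<alpha> \<gamma> *
     (sid \<gamma> \<beta> - (\<Sum>\<delta>\<in>{\<delta>. mdeg \<delta> < mdeg \<alpha>}. A \<gamma> \<delta> * lower_rinv A E \<delta> \<beta>)))"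
  by auto
termination by (relation "Wellfounded.measure (\<lambda>(A, E, \<alpha>, \<beta>). mdeg \<alpha>)") auto

declare lower_rinv.simps [simp del]

text \<open>The claim on the diagonal blocks of \<open>B\<close> is there so that the lemma can be
  applied to \<open>B\<close> in turn.\<close>

lemma lower_right_inverse:
  fixes A :: "'d::finite smat"
  assumes A: "block_lower A" and inv: "invertible_diag_blocks A"
  shows "\<exists>B. block_lower B \<and> invertible_diag_blocks B \<and> A \<star> B = sid"
proof -
  obtain E where E: "\<And>k \<alpha> \<beta>. \<alpha> \<in> level k \<Longrightarrow> \<beta> \<in> level k \<Longrightarrow>
     (\<Sum>\<gamma>\<in>level k. A \<alpha> \<gamma> * E k \<gamma> \<beta>) = (if \<alpha> = \<beta> then 1 else 0) \<and>
     (\<Sum>\<gamma>\<in>level k. E k \<alpha> \<gamma> * A \<gamma> \<beta>) = (if \<alpha> = \<beta> then 1 else 0)"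
    using inv[unfolded invertible_diag_blocks_def choice_iff] by blast
  \<comment> \<open>Row \<alpha> uses only the inverse of its own block, so the \<open>E k\<close>
    merge into one matrix.\<close>
  define B where "B = lower_rinv A (\<lambda>\<alpha>. E (mdeg \<alpha>) \<alpha>)"
  have B: "B \<alpha> \<beta> = (\<Sum>\<gamma>\<in>level k. E k \<alpha> \<gamma> *
     (sid \<gamma> \<beta> - (\<Sum>\<delta>\<in>{\<delta>. mdeg \<delta> < k}. A \<gamma> \<delta> * B \<delta> \<beta>)))" if "\<alpha> \<in> level k" for \<alpha> \<beta> k
    using that unfolding B_def by (subst lower_rinv.simps) (auto simp: level_def)
  have B0: "B \<alpha> \<beta> = 0" if "mdeg \<alpha> < mdeg \<beta>" for \<alpha> \<beta>
    using that
  \<comment> \<open>The rows \<delta> in the recursion have smaller degree, still below that of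
    \<beta>, so their entries vanish by induction.\<close>
  proof (induction "mdeg \<alpha>" arbitrary: \<alpha> rule: less_induct)
    case less
    have "B \<alpha> \<beta> = (\<Sum>\<gamma>\<in>level (mdeg \<alpha>). E (mdeg \<alpha>) \<alpha> \<gamma> *
     (sid \<gamma> \<beta> - (\<Sum>\<delta>\<in>{\<delta>. mdeg \<delta> < mdeg \<alpha>}. A \<gamma> \<delta> * B \<delta> \<beta>)))"
      by (rule B) (simp add: level_def)
    also have "\<dots> = 0"
      using less by (intro sum.neutral) (auto simp: level_def sid_def intro!: sum.neutral)
    finally show ?case .
  qed
  have diag: "B \<alpha> \<beta> = E k \<alpha> \<beta>" if "\<alpha> \<in> level k" "\<beta> \<in> level k" for \<alpha> \<beta> k
  proof -
    have "B \<alpha> \<beta> = (\<Sum>\<gamma>\<in>level k. E k \<alpha> \<gamma> * sid \<gamma> \<beta>)"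
      unfolding B[OF that(1)] using that(2)
      by (intro sum.cong) (auto simp: level_def B0 intro!: sum.neutral)
    then show ?thesis using that(2) by (simp add: finite_level)
  qed
  have "invertible_diag_blocks B"
    unfolding invertible_diag_blocks_def
    \<comment> \<open>Since the blocks of \<open>B\<close> are the \<open>E k\<close>, those of
      \<open>A\<close> invert them.\<close>
    by (intro allI exI[of _ A]) (use E in \<open>simp add: diag cong: sum.cong\<close>)
  moreover have "(A \<star> B) \<alpha> \<beta> = sid \<alpha> \<beta>" for \<alpha> \<beta>
  proof -
    define k where "k = mdeg \<alpha>"
    \<comment> \<open>The right-hand side left for row block \<open>k\<close>: there
      \<open>B\<close> is \<open>E k\<close> times \<open>X\<close>, so the diagonal block of
      \<open>A\<close> turns it back into \<open>X\<close>.\<close>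
    define X where "X \<gamma> = sid \<gamma> \<beta> - (\<Sum>\<delta>\<in>{\<delta>. mdeg \<delta> < k}. A \<gamma> \<delta> * B \<delta> \<beta>)" for \<gamma>
    have \<alpha>: "\<alpha> \<in> level k" by (simp add: level_def k_def)
    have "(A \<star> B) \<alpha> \<beta> = (\<Sum>\<gamma>\<in>level k \<union> {\<delta>. mdeg \<delta> < k}. A \<alpha> \<gamma> * B \<gamma> \<beta>)"
      using A by (intro star_eq_sum finite_UnI finite_level finite_mdeg_less)
        (auto simp: level_def k_def block_lower_def)
    also have "\<dots> = (\<Sum>\<gamma>\<in>level k. A \<alpha> \<gamma> * B \<gamma> \<beta>) + (\<Sum>\<gamma>\<in>{\<delta>. mdeg \<delta> < k}. A \<alpha> \<gamma> * B \<gamma> \<beta>)"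
      by (intro sum.union_disjoint finite_level finite_mdeg_less) (auto simp: level_def)
    also have "(\<Sum>\<gamma>\<in>level k. A \<alpha> \<gamma> * B \<gamma> \<beta>) = (\<Sum>\<gamma>\<in>level k. \<Sum>\<gamma>'\<in>level k. A \<alpha> \<gamma> * E k \<gamma> \<gamma>' * X \<gamma>')"
      by (intro sum.cong) (auto simp: B X_def sum_distrib_left mult.assoc)
    also have "\<dots> = (\<Sum>\<gamma>'\<in>level k. (\<Sum>\<gamma>\<in>level k. A \<alpha> \<gamma> * E k \<gamma> \<gamma>') * X \<gamma>')"
      unfolding sum_distrib_right by (rule sum.swap)
    also have "\<dots> = (\<Sum>\<gamma>'\<in>level k. if \<alpha> = \<gamma>' then X \<gamma>' else 0)"
      by (intro sum.cong) (auto simp: E[OF \<alpha>])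
    also have "\<dots> = X \<alpha>" using \<alpha> by (simp add: finite_level)
    finally show ?thesis by (simp add: X_def)
  qed
  ultimately show ?thesis
    using B0 by (intro exI[of _ B]) (auto simp: block_lower_def intro!: ext)
qed

text \<open>The right inverse \<open>B\<close> has itself a right inverse \<open>C\<close>, and
  \<open>A = A (B C) = (A B) C = C\<close>; hence \<open>B\<close> is also a left inverse of
  \<open>A\<close>.\<close>

lemma lower_inverse:
  assumes A: "block_lower A" "invertible_diag_blocks A"
  shows "\<exists>B. block_lower B \<and> A \<star> B = sid \<and> B \<star> A = sid"
proof -
  obtain B where B: "block_lower B" "invertible_diag_blocks B" "A \<star> B = sid"
    using lower_right_inverse[OF A] by blast
  obtain C where C: "B \<star> C = sid" using lower_right_inverse[OF B(1,2)] by blast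
  have "A = A \<star> (B \<star> C)" by (simp add: C)
  also have "\<dots> = C"
    using A(1) B by (simp add: star_assoc_rowfin[symmetric] rowfin_lower)
  finally show ?thesis using B C by blast
qed

lemma inv_in_block_lower:
  assumes A: "block_lower A" "invertible_diag_blocks A"
  shows "block_lower (inv_in block_lower A)"
    "A \<star> inv_in block_lower A = sid" "inv_in block_lower A \<star> A = sid"
proof -
  obtain B where B: "block_lower B" "A \<star> B = sid" "B \<star> A = sid"
    using lower_inverse[OF A] by blast
  have "inv_in block_lower A = B"
    by (rule inv_in_eqI) (use A B rowfin_lower in blast)+
  with B show "block_lower (inv_in block_lower A)"
    "A \<star> inv_in block_lower A = sid" "inv_in block_lower A \<star> A = sid" by simp_all
qed

lemma inv_in_block_diag:
  assumes A: "block_diag A" "invertible_diag_blocks A"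
  shows "block_diag (inv_in block_diag A)"
    "A \<star> inv_in block_diag A = sid" "inv_in block_diag A \<star> A = sid"
proof -
  obtain B where B: "block_diag B" "A \<star> B = sid" "B \<star> A = sid"
    using diag_inverse[OF A] by blast
  have "inv_in block_diag A = B"
    by (rule inv_in_eqI) (use A B rowfin_lower block_diag_lower in blast)+
  with B show "block_diag (inv_in block_diag A)"
    "A \<star> inv_in block_diag A = sid" "inv_in block_diag A \<star> A = sid" by simp_all
qed

text \<open>Reduced to the lower triangular case by transposition, which is why the blocks of the
  transpose are assumed invertible.\<close>

lemma inv_in_block_upper:
  assumes A: "block_upper A" "invertible_diag_blocks (stransp A)"
  shows "block_upper (inv_in block_upper A)"
    "A \<star> inv_in block_upper A = sid" "inv_in block_upper A \<star> A = sid"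
proof -
  have "block_lower (stransp A)" using A(1) block_upper_stransp[of "stransp A"] by simp
  then obtain B where B: "block_lower B" "stransp A \<star> B = sid" "B \<star> stransp A = sid"
    using lower_inverse A by blast
  then have B': "block_upper (stransp B)" "A \<star> stransp B = sid" "stransp B \<star> A = sid"
    using stransp_star[of B "stransp A"] stransp_star[of "stransp A" B]
    by (simp_all add: block_upper_stransp)
  have "inv_in block_upper A = stransp B"
    by (rule inv_in_eqI) (use A B' colfin_upper in blast)+
  with B' show "block_upper (inv_in block_upper A)"
    "A \<star> inv_in block_upper A = sid" "inv_in block_upper A \<star> A = sid" by simp_all
qed

lemma id_diag_blocks_invertible:
  fixes A :: "'d::finite smat"
  assumes "id_diag_blocks A"
  shows "invertible_diag_blocks A"
  unfolding invertible_diag_blocks_def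
proof (intro allI exI[of _ "sid :: 'd smat"] ballI)
  fix k and \<alpha> \<beta> :: "'d mi" assume "\<alpha> \<in> level k" "\<beta> \<in> level k"
  moreover have "A \<gamma> \<delta> = sid \<gamma> \<delta>" if "\<gamma> \<in> level k" "\<delta> \<in> level k" for \<gamma> \<delta>
    using that assms by (simp add: id_diag_blocks_def sid_def)
  ultimately show "(\<Sum>\<gamma>\<in>level k. A \<alpha> \<gamma> * sid \<gamma> \<beta>) = (if \<alpha> = \<beta> then 1 else 0) \<and>
     (\<Sum>\<gamma>\<in>level k. sid \<alpha> \<gamma> * A \<gamma> \<beta>) = (if \<alpha> = \<beta> then 1 else 0)"
    by (simp add: finite_level cong: sum.cong) (simp add: sid_def)
qed

subsection \<open>The matrices \<open>v \<cdot> \<Lambda> - c\<close>\<close>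

text \<open>Taking \<open>c = 0\<close> gives \<open>v\<close> dotted with \<open>Lam\<close>, so
  one commutation lemma covers both kinds of operators.\<close>

definition lin_shift :: "'d::finite rvec \<Rightarrow> real \<Rightarrow> 'd smat" where
  "lin_shift v c = (\<lambda>\<alpha> \<beta>. dotmat v Lam \<alpha> \<beta> - c * sid \<alpha> \<beta>)"

text \<open>Both the finiteness of rows and the block upper form are read off from this
  support.\<close>

lemma lin_shift_nonzero:
  "lin_shift v c \<alpha> \<beta> \<noteq> 0 \<Longrightarrow> \<beta> \<in> insert \<alpha> (range (\<lambda>b. \<alpha> + axis b 1))"
  by (rule ccontr, erule notE)
    (auto simp: lin_shift_def dotmat_def Lam_def sid_def image_iff intro!: sum.neutral)

lemma rowfin_lin_shift [simp]: "rowfin (lin_shift v c)"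
  by (rule rowfin_subset[OF _ lin_shift_nonzero]) auto

lemma block_upper_lin_shift: "block_upper (lin_shift v c)"
  unfolding block_upper_def
proof (intro allI impI)
  fix \<alpha> \<beta> :: "'a mi" assume "mdeg \<beta> < mdeg \<alpha>"
  then have "\<beta> \<notin> insert \<alpha> (range (\<lambda>b. \<alpha> + axis b 1))" by auto
  then show "lin_shift v c \<alpha> \<beta> = 0" using lin_shift_nonzero by blast
qed

lemma colfin_lin_shift [simp]: "colfin (lin_shift v c)"
  by (rule colfin_upper[OF block_upper_lin_shift])

lemma lin_shift_0: "lin_shift v 0 = dotmat v Lam"
  by (simp add: lin_shift_def)

text \<open>Rows of \<open>lin_shift\<close> are finite, so \<open>B\<close> may be arbitrary; it
  will be a moment matrix, where raising the row label by \<open>axis b 1\<close> means multiplying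
  the integrand by \<open>x $ b\<close>.\<close>

lemma lin_shift_star:
  "(lin_shift v c \<star> B) \<alpha> \<beta> = (\<Sum>b\<in>UNIV. v $ b * B (\<alpha> + axis b 1) \<beta>) - c * B \<alpha> \<beta>"
proof -
  let ?F = "insert \<alpha> (range (\<lambda>b. \<alpha> + axis b 1))"
  have F: "finite ?F" by simp
  have "(lin_shift v c \<star> B) \<alpha> \<beta> = (\<Sum>\<gamma>\<in>?F. lin_shift v c \<alpha> \<gamma> * B \<gamma> \<beta>)"
    by (rule star_eq_sum[OF F]) (metis lin_shift_nonzero mult_zero_left)
  also have "\<dots> = (\<Sum>\<gamma>\<in>?F. \<Sum>b\<in>UNIV. v $ b * (Lam b \<alpha> \<gamma> * B \<gamma> \<beta>)) - c * (\<Sum>\<gamma>\<in>?F. sid \<alpha> \<gamma> * B \<gamma> \<beta>)"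
    unfolding lin_shift_def dotmat_def
    by (simp only: left_diff_distrib sum_subtractf sum_distrib_left sum_distrib_right mult.assoc)
  also have "(\<Sum>\<gamma>\<in>?F. \<Sum>b\<in>UNIV. v $ b * (Lam b \<alpha> \<gamma> * B \<gamma> \<beta>)) =
      (\<Sum>b\<in>UNIV. v $ b * (\<Sum>\<gamma>\<in>?F. Lam b \<alpha> \<gamma> * B \<gamma> \<beta>))"
    unfolding sum_distrib_left by (rule sum.swap)
  also have "(\<lambda>b. \<Sum>\<gamma>\<in>?F. Lam b \<alpha> \<gamma> * B \<gamma> \<beta>) = (\<lambda>b. B (\<alpha> + axis b 1) \<beta>)"
  proof
    fix b
    have "(\<Sum>\<gamma>\<in>?F. Lam b \<alpha> \<gamma> * B \<gamma> \<beta>) = (\<Sum>\<gamma>\<in>?F. if \<alpha> + axis b 1 = \<gamma> then B \<gamma> \<beta> else 0)"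
      by (intro sum.cong) (auto simp: Lam_def)
    also have "\<dots> = B (\<alpha> + axis b 1) \<beta>" by (subst sum.delta'[OF F]) auto
    finally show "(\<Sum>\<gamma>\<in>?F. Lam b \<alpha> \<gamma> * B \<gamma> \<beta>) = B (\<alpha> + axis b 1) \<beta>" .
  qed
  finally show ?thesis by (simp only: sum_sid(2)[OF F] insertI1 if_True)
qed

lemma lin_shift_commute: "lin_shift v c \<star> lin_shift w d = lin_shift w d \<star> lin_shift v c"
proof -
  \<comment> \<open>The entries of the quadratic part, symmetric in \<open>v\<close> and
    \<open>w\<close> because adding two unit vectors to \<alpha> does not depend on their
    order.\<close>
  define X where "X v w \<alpha> \<beta> = (\<Sum>b\<in>UNIV. v $ b * dotmat w Lam (\<alpha> + axis b 1) \<beta>)"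
    for v w :: "'a rvec" and \<alpha> \<beta>
  have X: "X v w \<alpha> \<beta> = X w v \<alpha> \<beta>" for v w \<alpha> \<beta>
    unfolding X_def dotmat_def sum_distrib_left
    by (subst sum.swap, intro sum.cong refl) (simp add: Lam_def ac_simps)
  have "(lin_shift v c \<star> lin_shift w d) \<alpha> \<beta> =
      X v w \<alpha> \<beta> - d * dotmat v Lam \<alpha> \<beta> - c * dotmat w Lam \<alpha> \<beta> + c * d * sid \<alpha> \<beta>"
    for v w c d \<alpha> \<beta>
  proof -
    have "d * dotmat v Lam \<alpha> \<beta> = (\<Sum>b\<in>UNIV. v $ b * (d * sid (\<alpha> + axis b 1) \<beta>))"
      unfolding dotmat_def sum_distrib_left
      by (intro sum.cong refl) (simp add: sid_def Lam_def)
    then show ?thesis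
      unfolding lin_shift_star X_def
      by (simp add: lin_shift_def right_diff_distrib sum_subtractf)
  qed
  then show ?thesis by (intro ext) (simp add: X[of v w])
qed

text \<open>The matrices \<open>Lam b\<close> change the degree, so each diagonal block is
  \<open>- c\<close> times the identity.\<close>

lemma invertible_diag_blocks_lin_shift:
  assumes "c \<noteq> 0"
  shows "invertible_diag_blocks (stransp (lin_shift v c))"
  unfolding invertible_diag_blocks_def
proof (intro allI exI[of _ "\<lambda>\<alpha> \<beta>. sid \<alpha> \<beta> / - c"] ballI)
  fix k and \<alpha> \<beta> :: "'a mi" assume "\<alpha> \<in> level k" "\<beta> \<in> level k"
  moreover have "stransp (lin_shift v c) \<gamma> \<delta> = - c * sid \<gamma> \<delta>"
    if "\<gamma> \<in> level k" "\<delta> \<in> level k" for \<gamma> \<delta>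
  proof -
    have "Lam b \<delta> \<gamma> = 0" for b using that mdeg_axis[of \<delta> b] by (auto simp: Lam_def level_def)
    then show ?thesis by (simp add: stransp_def lin_shift_def dotmat_def sid_def)
  qed
  ultimately show "(\<Sum>\<gamma>\<in>level k. stransp (lin_shift v c) \<alpha> \<gamma> * (sid \<gamma> \<beta> / - c)) = (if \<alpha> = \<beta> then 1 else 0) \<and>
     (\<Sum>\<gamma>\<in>level k. (sid \<alpha> \<gamma> / - c) * stransp (lin_shift v c) \<gamma> \<beta>) = (if \<alpha> = \<beta> then 1 else 0)"
    using assms by (simp add: finite_level cong: sum.cong) (simp add: sid_def)
qed

lemma lin_shift_inverse:
  assumes "c \<noteq> 0"
  shows "colfin (inv_in block_upper (lin_shift v c))"
    "lin_shift v c \<star> inv_in block_upper (lin_shift v c) = sid"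
    "inv_in block_upper (lin_shift v c) \<star> lin_shift v c = sid"
  by (simp_all add: inv_in_block_upper block_upper_lin_shift invertible_diag_blocks_lin_shift
      assms colfin_upper)

section \<open>Integer powers and the matrix \<open>W0\<close>\<close>

lemma spow_simps [simp]: "spow A 0 = sid" "spow A (Suc k) = A \<star> spow A k"
  by (simp_all add: spow_def)

lemma colfin_spow: "colfin A \<Longrightarrow> colfin (spow A k)"
  by (induction k) simp_all

lemma spow_commute:
  assumes "colfin A" "colfin B" "A \<star> B = B \<star> A"
  shows "A \<star> spow B k = spow B k \<star> A"
proof (induction k)
  case (Suc k)
  have "A \<star> spow B (Suc k) = (A \<star> B) \<star> spow B k"
    using assms(1,2) by (simp add: star_assoc_colfin colfin_spow)
  also have "\<dots> = B \<star> (A \<star> spow B k)"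
    unfolding assms(3) using assms by (simp add: star_assoc_colfin colfin_spow)
  also have "\<dots> = spow B (Suc k) \<star> A"
    unfolding Suc.IH using assms by (simp add: star_assoc_colfin colfin_spow)
  finally show ?case .
qed simp

lemma colfin_upper_powi:
  "c \<noteq> 0 \<Longrightarrow> colfin (upper_powi (lin_shift v c) k)"
  by (simp add: upper_powi_def colfin_spow lin_shift_inverse)

lemma upper_powi_Suc:
  assumes "c \<noteq> 0"
  shows "upper_powi (lin_shift v c) (k + 1) = lin_shift v c \<star> upper_powi (lin_shift v c) k"
proof (cases "0 \<le> k")
  case True
  then show ?thesis by (simp add: upper_powi_def nat_add_distrib)
next
  case False
  \<comment> \<open>Thus \<open>k + 1 = - int n\<close>: one inverse cancels and \<open>n\<close>
    remain. For \<open>n = 0\<close> the power on the left falls into the nonnegative branch of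
    \<open>upper_powi\<close>, hence the later case split.\<close>
  define n where "n = nat (- k - 1)"
  have k: "k = - 1 - int n" using False by (simp add: n_def)
  have "lin_shift v c \<star> (inv_in block_upper (lin_shift v c) \<star> B) = B" if "colfin B" for B
    using that by (simp add: lin_shift_inverse assms flip: star_assoc_colfin)
  then have "upper_powi (lin_shift v c) (- int n) = lin_shift v c \<star> upper_powi (lin_shift v c) k"
    by (cases n) (simp_all add: k upper_powi_def nat_add_distrib colfin_spow lin_shift_inverse assms)
  then show ?thesis by (simp add: k)
qed

text \<open>An inverse commutes with whatever its matrix commutes with: insert
  \<open>I \<star> lin_shift w d\<close>, swap, and cancel on the other side. Powers follow by
  \<open>spow_commute\<close>.\<close>

lemma upper_powi_commute:
  assumes d: "d \<noteq> 0"
  shows "lin_shift v c \<star> upper_powi (lin_shift w d) k = upper_powi (lin_shift w d) k \<star> lin_shift v c"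
proof -
  define I where "I = inv_in block_upper (lin_shift w d)"
  note I = lin_shift_inverse[OF d, of w, folded I_def]
  have "lin_shift v c \<star> I = (I \<star> lin_shift w d) \<star> (lin_shift v c \<star> I)"
    by (simp add: I)
  also have "\<dots> = I \<star> ((lin_shift w d \<star> lin_shift v c) \<star> I)"
    using I(1) by (simp add: star_assoc_colfin)
  also have "\<dots> = I \<star> (lin_shift v c \<star> (lin_shift w d \<star> I))"
    using I(1) by (simp add: star_assoc_colfin lin_shift_commute[of w])
  finally have "lin_shift v c \<star> I = I \<star> lin_shift v c" by (simp add: I)
  then show ?thesis
    unfolding upper_powi_def by (simp add: spow_commute lin_shift_commute I(1) flip: I_def)
qed

text \<open>The list is general for the induction. Distinctness ensures that raising
  \<open>m $ a\<close> changes at most one factor; the additional \<open>lin_shift\<close> then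
  commutes past the factors before it. Column-finiteness of the tail, needed for rebracketing, is
  proved alongside.\<close>

lemma foldr_upper_powi:
  fixes N :: "'d::finite rmat"
  assumes q: "\<And>a. q $ a \<noteq> 0" and "distinct xs"
  defines "W \<equiv> \<lambda>m. foldr (\<lambda>b B. upper_powi (lin_shift (N $ b) (q $ b)) (m $ b) \<star> B) xs sid"
  shows "colfin (W m)"
    and "W (m + axis a 1) = (if a \<in> set xs then lin_shift (N $ a) (q $ a) \<star> W m else W m)"
  using \<open>distinct xs\<close> unfolding W_def
proof (induction xs)
  case (Cons b xs)
  let ?f = "\<lambda>m b B. upper_powi (lin_shift (N $ b) (q $ b)) (m $ b) \<star> B"
  let ?L = "lin_shift (N $ a) (q $ a)"
  let ?P = "upper_powi (lin_shift (N $ b) (q $ b)) (m $ b)"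
  let ?W = "foldr (?f m) xs sid"
  have P: "colfin ?P" using q by (simp add: colfin_upper_powi)
  {
    case 1
    show ?case using P Cons.IH 1 by simp
  next
    case 2
    have W: "colfin ?W" using Cons.IH(1) 2 by simp
    show ?case
    proof (cases "a = b")
      case True
      then have "a \<notin> set xs" using 2 by simp
      then have "foldr (?f (m + axis a 1)) (b # xs) sid = (?L \<star> ?P) \<star> ?W"
        using 2 True Cons.IH(2) by (simp add: upper_powi_Suc q)
      also have "\<dots> = ?L \<star> (?P \<star> ?W)" using P W by (simp add: star_assoc_colfin)
      finally show ?thesis using True by simp
    next
      case False
      have "?P \<star> (?L \<star> ?W) = (?P \<star> ?L) \<star> ?W" using W by (simp add: star_assoc_colfin)
      also have "\<dots> = ?L \<star> (?P \<star> ?W)"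
        unfolding upper_powi_commute[OF q, symmetric] using W P by (simp add: star_assoc_colfin)
      finally show ?thesis using False 2 Cons.IH(2) by (auto simp: axis_def)
    qed
  }
qed simp_all

lemma W0_shift:
  assumes "\<And>a. q $ a \<noteq> 0"
  shows "W0 N q (m + axis a 1) = lin_shift (N $ a) (q $ a) \<star> W0 N q m"
  using foldr_upper_powi(2)[where N = N and m = m and a = a, OF assms distinct_sorted_list_of_set[of UNIV]]
  by (simp add: W0_def lin_shift_def)

text \<open>Linearity in the middle factor; it gives the combination of Jacobi matrices the form of
  a conjugate of \<open>dotmat v Lam\<close> by \<open>S m\<close>.\<close>

lemma dotmat_star:
  assumes A: "rowfin A" and X: "\<And>b. rowfin (X b)"
  shows "dotmat v (\<lambda>b. A \<star> X b \<star> B) = A \<star> dotmat v X \<star> B"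
proof -
  have 1: "dotmat v (\<lambda>b. A \<star> Y b) = A \<star> dotmat v Y" for Y
  proof (intro ext)
    fix \<alpha> \<beta>
    show "dotmat v (\<lambda>b. A \<star> Y b) \<alpha> \<beta> = (A \<star> dotmat v Y) \<alpha> \<beta>"
      unfolding dotmat_def star_rowfin[OF A] sum_distrib_left
      by (subst sum.swap) (simp add: mult.left_commute)
  qed
  have 2: "dotmat v (\<lambda>b. X b \<star> B) = dotmat v X \<star> B"
  proof (intro ext)
    fix \<alpha> \<beta>
    \<comment> \<open>One finite index set serving all \<open>b\<close>, so that the sums can be
      exchanged.\<close>
    let ?F = "\<Union>b. {\<gamma>. X b \<alpha> \<gamma> \<noteq> 0}"
    have F: "finite ?F" using X by (auto simp: rowfin_def)
    have "dotmat v (\<lambda>b. X b \<star> B) \<alpha> \<beta> = (\<Sum>b\<in>UNIV. v $ b * (\<Sum>\<gamma>\<in>?F. X b \<alpha> \<gamma> * B \<gamma> \<beta>))"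
      unfolding dotmat_def by (intro sum.cong refl arg_cong2[where f="(*)"] star_eq_sum[OF F]) auto
    also have "\<dots> = (\<Sum>\<gamma>\<in>?F. (\<Sum>b\<in>UNIV. v $ b * X b \<alpha> \<gamma>) * B \<gamma> \<beta>)"
      unfolding sum_distrib_left sum_distrib_right mult.assoc by (rule sum.swap)
    also have "\<dots> = (dotmat v X \<star> B) \<alpha> \<beta>"
      unfolding dotmat_def by (rule star_eq_sum[OF F, symmetric]) (auto intro!: sum.neutral)
    finally show "dotmat v (\<lambda>b. X b \<star> B) \<alpha> \<beta> = (dotmat v X \<star> B) \<alpha> \<beta>" .
  qed
  have dX: "rowfin (dotmat v X)"
  proof (rule rowfin_subset)
    fix \<alpha> \<beta>
    show "finite (\<Union>b. {\<gamma>. X b \<alpha> \<gamma> \<noteq> 0})" using X by (auto simp: rowfin_def)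
    assume "dotmat v X \<alpha> \<beta> \<noteq> 0"
    then obtain b where "v $ b * X b \<alpha> \<beta> \<noteq> 0"
      unfolding dotmat_def by (meson sum.neutral)
    then show "\<beta> \<in> (\<Union>b. {\<gamma>. X b \<alpha> \<gamma> \<noteq> 0})" by auto
  qed
  show ?thesis by (simp add: star_assoc_rowfin A X dX 1 flip: 2)
qed

subsection \<open>Moment matrices\<close>

lemma closed_msupport: "closed (msupport \<mu>)"
proof -
  have "- msupport \<mu> = \<Union>{U. open U \<and> emeasure \<mu> U = 0}" by (auto simp: msupport_def)
  then show ?thesis unfolding closed_def by auto
qed

text \<open>The complement is a possibly uncountable union of open null sets; the Lindelof property
  extracts a countable subfamily with the same union.\<close>

lemma AE_msupport:
  assumes "sets \<mu> = sets borel"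
  shows "AE x in \<mu>. x \<in> msupport \<mu>"
proof -
  let ?F = "{U. open U \<and> emeasure \<mu> U = 0}"
  obtain F' where F': "F' \<subseteq> ?F" "countable F'" "\<Union>F' = \<Union>?F"
    by (rule Lindelof[of ?F]) auto
  have "\<Union>F' \<in> null_sets \<mu>"
  proof -
    have "(\<Union>U\<in>F'. U) \<in> null_sets \<mu>"
      using F'(1) assms by (intro null_sets_UN'[OF F'(2)]) (auto simp: null_sets_def)
    then show ?thesis by simp
  qed
  moreover have "- msupport \<mu> = \<Union>F'" unfolding F'(3) by (auto simp: msupport_def)
  ultimately show ?thesis by (intro AE_I'[of "\<Union>F'"]) auto
qed

text \<open>Closedness comes from the support itself; boundedness because \<open>N\<close> maps it
  into a box and is invertible.\<close>

lemma compact_msupport: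
  fixes N :: "'d::finite rmat"
  assumes "invertible N" "msupport \<mu> \<subseteq> {x. \<forall>a. \<bar>N $ a \<bullet> x\<bar> < \<bar>q $ a\<bar>}"
  shows "compact (msupport \<mu>)"
proof -
  obtain N' where N': "N' ** N = mat 1" using assms(1) by (auto simp: invertible_def)
  let ?B = "cbox (\<chi> a. - \<bar>q $ a\<bar>) (\<chi> a. \<bar>q $ a\<bar>)"
  have "msupport \<mu> \<subseteq> ((*v) N') ` ?B"
  proof
    fix x assume "x \<in> msupport \<mu>"
    then have x: "\<bar>N $ a \<bullet> x\<bar> < \<bar>q $ a\<bar>" for a using assms(2) by blast
    have "N *v x \<in> ?B"
      unfolding mem_box_cart matrix_vector_mul_component
    proof (intro allI)
      fix a
      show "(\<chi> a. - \<bar>q $ a\<bar>) $ a \<le> N $ a \<bullet> x \<and> N $ a \<bullet> x \<le> (\<chi> a. \<bar>q $ a\<bar>) $ a"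
        using x[of a] by (simp add: abs_less_iff)
    qed
    moreover have "x = N' *v (N *v x)"
      by (simp add: matrix_vector_mul_assoc N')
    ultimately show "x \<in> ((*v) N') ` ?B" by blast
  qed
  moreover have "bounded (((*v) N') ` ?B)"
    by (intro bounded_linear_image bounded_cbox matrix_vector_mul_bounded_linear)
  ultimately show ?thesis
    using closed_msupport compact_eq_bounded_closed bounded_subset by blast
qed

section \<open>Monomials, weights and their integrals\<close>

lemma monomial_add: "monomial (\<alpha> + \<beta>) x = monomial \<alpha> x * monomial \<beta> x"
  by (simp add: monomial_def power_add prod.distrib)

lemma monomial_axis: "monomial (\<alpha> + axis b 1) x = x $ b * monomial \<alpha> x"
proof -
  have "monomial (axis b 1) x = (\<Prod>c\<in>UNIV. if c = b then x $ c else 1)"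
    unfolding monomial_def by (rule prod.cong) (auto simp: axis_def)
  then show ?thesis unfolding monomial_add by simp
qed

text \<open>At a zero of the factor this can fail for \<open>m $ a = -1\<close>:
  \<open>0 powi 0\<close> is 1, while the right side is 0.\<close>

lemma weight_shift:
  assumes "N $ a \<bullet> x \<noteq> q $ a"
  shows "weight N q (m + axis a 1) x = (N $ a \<bullet> x - q $ a) * weight N q m x"
proof -
  have "weight N q (m + axis a 1) x =
      (N $ a \<bullet> x - q $ a) powi (m $ a + 1) * (\<Prod>b\<in>UNIV - {a}. (N $ b \<bullet> x - q $ b) powi (m $ b))"
    unfolding weight_def by (subst prod.remove[of _ a]) (auto simp: axis_def intro!: prod.cong)
  also have "\<dots> = (N $ a \<bullet> x - q $ a) * weight N q m x"
    unfolding weight_def using assms by (subst (2) prod.remove[of _ a]) (auto simp: power_int_add_1')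
  finally show ?thesis .
qed

lemma continuous_monomial: "continuous_on UNIV (monomial \<alpha>)"
  unfolding monomial_def by (intro continuous_intros)

lemma borel_measurable_weight [measurable]: "weight N q m \<in> borel_measurable borel"
  unfolding weight_def power_int_def by measurable

text \<open>No factor of the weight vanishes on the compact support, so even with negative exponents
  the weight is continuous and bounded there, and a multiple of
  \<open>monomial (\<alpha> + \<beta>)\<close> dominates.\<close>

lemma integrable_moment:
  fixes N :: "'d::finite rmat"
  assumes "invertible N" and sets: "sets \<mu> = sets borel"
    and mono: "\<And>\<alpha>. integrable \<mu> (monomial \<alpha>)"
    and supp: "msupport \<mu> \<subseteq> {x. \<forall>a. \<bar>N $ a \<bullet> x\<bar> < \<bar>q $ a\<bar>}"
  shows "integrable \<mu> (\<lambda>x. monomial \<alpha> x * weight N q m x * monomial \<beta> x)"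
proof -
  have "N $ a \<bullet> x - q $ a \<noteq> 0" if "x \<in> msupport \<mu>" for a x
  proof -
    have "\<bar>N $ a \<bullet> x\<bar> < \<bar>q $ a\<bar>" using supp that by blast
    then show ?thesis by auto
  qed
  then have "continuous_on (msupport \<mu>) (weight N q m)"
    unfolding weight_def by (intro continuous_intros) auto
  then have "bounded (weight N q m ` msupport \<mu>)"
    using compact_msupport[OF assms(1) supp] by (intro compact_imp_bounded compact_continuous_image)
  then obtain C where C: "\<And>x. x \<in> msupport \<mu> \<Longrightarrow> \<bar>weight N q m x\<bar> \<le> C"
    by (auto simp: bounded_iff)
  have [measurable]: "monomial \<alpha> \<in> borel_measurable borel" for \<alpha> :: "'d mi"
    by (rule borel_measurable_continuous_onI[OF continuous_monomial])
  note [measurable_cong] = sets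
  show ?thesis
  proof (rule Bochner_Integration.integrable_bound)
    show "integrable \<mu> (\<lambda>x. C * monomial (\<alpha> + \<beta>) x)" using mono by simp
    show "AE x in \<mu>. norm (monomial \<alpha> x * weight N q m x * monomial \<beta> x)
        \<le> norm (C * monomial (\<alpha> + \<beta>) x)"
      using AE_msupport[OF sets]
    proof eventually_elim
      case (elim x)
      have "\<bar>weight N q m x\<bar> * \<bar>monomial (\<alpha> + \<beta>) x\<bar> \<le> \<bar>C\<bar> * \<bar>monomial (\<alpha> + \<beta>) x\<bar>"
        using C[OF elim] by (intro mult_right_mono) auto
      then show ?case by (simp add: monomial_add abs_mult ac_simps)
    qed
  qed measurable
qed

lemma moment_matrix_shift:
  fixes N :: "'d::finite rmat"
  assumes "invertible N" and sets: "sets \<mu> = sets borel"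
    and "\<And>\<alpha>. integrable \<mu> (monomial \<alpha>)"
    and supp: "msupport \<mu> \<subseteq> {x. \<forall>a. \<bar>N $ a \<bullet> x\<bar> < \<bar>q $ a\<bar>}"
  shows "moment_matrix N q \<mu> (m + axis a 1) = lin_shift (N $ a) (q $ a) \<star> moment_matrix N q \<mu> m"
proof (intro ext)
  fix \<alpha> \<beta>
  let ?f = "\<lambda>\<alpha> x. monomial \<alpha> x * weight N q m x * monomial \<beta> x"
  have f: "integrable \<mu> (?f \<alpha>)" for \<alpha> by (rule integrable_moment[OF assms])
  have "moment_matrix N q \<mu> (m + axis a 1) \<alpha> \<beta> =
      (\<integral>x. (\<Sum>b\<in>UNIV. N $ a $ b * ?f (\<alpha> + axis b 1) x) - q $ a * ?f \<alpha> x \<partial>\<mu>)"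
    unfolding moment_matrix_def
  \<comment> \<open>Almost everywhere suffices: \<open>weight_shift\<close> is available on the
    support, where the factor is nonzero.\<close>
  proof (rule integral_cong_AE)
    show "(\<lambda>x. monomial \<alpha> x * weight N q (m + axis a 1) x * monomial \<beta> x) \<in> borel_measurable \<mu>"
      by (intro borel_measurable_integrable integrable_moment[OF assms])
    show "(\<lambda>x. (\<Sum>b\<in>UNIV. N $ a $ b * ?f (\<alpha> + axis b 1) x) - q $ a * ?f \<alpha> x) \<in> borel_measurable \<mu>"
      using f by (intro borel_measurable_integrable) auto
    show "AE x in \<mu>. monomial \<alpha> x * weight N q (m + axis a 1) x * monomial \<beta> x =
        (\<Sum>b\<in>UNIV. N $ a $ b * ?f (\<alpha> + axis b 1) x) - q $ a * ?f \<alpha> x"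
      using AE_msupport[OF sets]
    proof eventually_elim
      case (elim x)
      then have "\<bar>N $ a \<bullet> x\<bar> < \<bar>q $ a\<bar>" using supp by blast
      then have "N $ a \<bullet> x \<noteq> q $ a" by auto
      moreover have "(\<Sum>b\<in>UNIV. N $ a $ b * ?f (\<alpha> + axis b 1) x) = (N $ a \<bullet> x) * ?f \<alpha> x"
        unfolding monomial_axis by (simp add: inner_vec_def sum_distrib_right mult.assoc)
      ultimately show ?case by (simp add: weight_shift algebra_simps)
    qed
  qed
  also have "\<dots> = (\<Sum>b\<in>UNIV. N $ a $ b * integral\<^sup>L \<mu> (?f (\<alpha> + axis b 1))) - q $ a * integral\<^sup>L \<mu> (?f \<alpha>)"
    using f by simp
  finally show "moment_matrix N q \<mu> (m + axis a 1) \<alpha> \<beta> =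
      (lin_shift (N $ a) (q $ a) \<star> moment_matrix N q \<mu> m) \<alpha> \<beta>"
    by (simp add: lin_shift_star moment_matrix_def)
qed

subsection \<open>The integrable discrete flows\<close>

theorem proposition3p1p8:
  fixes N :: "'d::{finite,linorder} rmat"
    and q :: "'d rvec"
    and \<mu> :: "'d rvec measure"
    and S H :: "'d zvec \<Rightarrow> 'd smat"
  assumes "invertible N"
    and "\<And>a. q $ a \<noteq> 0"
    and "sets \<mu> = sets borel"
    and "\<And>\<alpha>. integrable \<mu> (monomial \<alpha>)"
    and "msupport \<mu> \<subseteq> {x. \<forall>a. \<bar>N $ a \<bullet> x\<bar> < \<bar>q $ a\<bar>}"
    and "\<And>m. block_lower (S m) \<and> id_diag_blocks (S m)"
    and "\<And>m. block_diag (H m) \<and> invertible_diag_blocks (H m)"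
    and "\<And>m. moment_matrix N q \<mu> m =
           inv_in block_lower (S m) \<star> H m \<star> stransp (inv_in block_lower (S m))"
  shows
    "(\<forall>a m. shift a (W1 N q S) m = resolvent S H a m \<star> W1 N q S m \<and>
            shift a (W2 S H) m = resolvent S H a m \<star> W2 S H m) \<and>
     (\<forall>a b m. shift b (nJ (N $ a) S) m \<star> resolvent S H b m =
                resolvent S H b m \<star> nJ (N $ a) S m \<and>
              Mmat S b m \<star> shift b (nJ (N $ a) S) m = nJ (N $ a) S m \<star> Mmat S b m) \<and>
     (\<forall>a b m. shift a (resolvent S H b) m \<star> resolvent S H a m =
                shift b (resolvent S H a) m \<star> resolvent S H b m \<and>
              Mmat S a m \<star> shift a (Mmat S b) m = Mmat S b m \<star> shift b (Mmat S a) m)"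
proof -
  define R where "R m = inv_in block_lower (S m)" for m
  define H' where "H' m = inv_in block_diag (H m)" for m
  define L where "L a = lin_shift (N $ a) (q $ a)" for a
  define K where "K a = dotmat (N $ a) Lam" for a
  have S: "block_lower (S m)" "invertible_diag_blocks (S m)" for m
    using assms(6) id_diag_blocks_invertible by blast+
  have R: "block_lower (R m)" "S m \<star> R m = sid" "R m \<star> S m = sid" for m
    unfolding R_def by (rule inv_in_block_lower[OF S])+
  have H': "block_diag (H' m)" "H m \<star> H' m = sid" "H' m \<star> H m = sid" for m
    unfolding H'_def using assms(7) by (blast intro: inv_in_block_diag)+
  have fin [simp]: "rowfin (S m)" "rowfin (R m)" "rowfin (H m)" "rowfin (H' m)" "rowfin (L a)" "rowfin (K a)"
    for m a
    using S R assms(7) H'(1)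
    by (auto intro: rowfin_lower rowfin_lower[OF block_diag_lower] simp: L_def K_def simp flip: lin_shift_0)
  have cofin [simp]: "colfin (H m)" "colfin (H' m)" "colfin (stransp (S m))" "colfin (stransp (R m))" for m
    using assms(7) H'(1) by (auto intro: colfin_upper[OF block_diag_upper])
  \<comment> \<open>The trailing \<open>X\<close> makes the rules applicable inside products
    bracketed to the right.\<close>
  have cancel [simp]: "S m \<star> (R m \<star> X) = X" "R m \<star> (S m \<star> X) = X" for m X
    by (simp_all add: R flip: star_assoc_rowfin)
  have comm: "L a \<star> L b = L b \<star> L a" "K a \<star> L b = L b \<star> K a" for a b
    by (simp_all add: L_def K_def lin_shift_commute flip: lin_shift_0)
  have M: "Mmat S a m = S m \<star> R (m + axis a 1)" for a m
    by (simp add: Mmat_def R_def shift_def)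
  have J: "nJ (N $ a) S m = S m \<star> (K a \<star> R m)" for a m
  proof -
    have "rowfin (Lam b :: 'd smat)" for b
      by (rule rowfin_subset[of "\<lambda>\<alpha>. {\<alpha> + axis b 1}"]) (auto simp: Lam_def split: if_splits)
    then have "nJ (N $ a) S m = S m \<star> K a \<star> R m"
      by (simp add: nJ_def Jac_def dotmat_star K_def flip: R_def)
    then show ?thesis by (simp add: star_assoc_rowfin)
  qed
  \<comment> \<open>The defining expression with the transpose expanded. From the second on, all
    factors are column-finite, which permits this bracketing.\<close>
  have \<omega>_diag: "resolvent S H a m =
      H (m + axis a 1) \<star> (stransp (R (m + axis a 1)) \<star> (stransp (S m) \<star> H' m))" for a m
    by (simp add: resolvent_def shift_def M stransp_star star_assoc_colfin flip: H'_def)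
  have G: "moment_matrix N q \<mu> m = R m \<star> (H m \<star> stransp (R m))" for m
    using assms(8)[of m] by (simp add: R_def star_assoc_rowfin flip: R_def)
  have \<omega>: "resolvent S H a m = S (m + axis a 1) \<star> (L a \<star> R m)" for a m
  proof -
    let ?m = "m + axis a 1"
    \<comment> \<open>Multiplying the shifted moment matrix by \<open>S ?m\<close> removes its lower
      factor; its other expression, \<open>L a\<close> times the unshifted matrix, is then
      factorized at \<open>m\<close>.\<close>
    have "H ?m \<star> stransp (R ?m) = S ?m \<star> moment_matrix N q \<mu> ?m"
      by (simp add: G)
    also have "\<dots> = S ?m \<star> (L a \<star> moment_matrix N q \<mu> m)"
      using moment_matrix_shift[OF assms(1,3,4,5)] by (simp add: L_def)
    also have "\<dots> = S ?m \<star> (L a \<star> R m) \<star> (H m \<star> stransp (R m))"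
      by (simp add: G star_assoc_rowfin)
    finally have *: "H ?m \<star> stransp (R ?m) = S ?m \<star> (L a \<star> R m) \<star> (H m \<star> stransp (R m))" .
    \<comment> \<open>Multiplying \<open>*\<close> on the right by
      \<open>stransp (S m) \<star> H' m\<close> completes the resolvent on the left and cancels the
      factors after \<open>R m\<close> on the right.\<close>
    have "resolvent S H a m = H ?m \<star> stransp (R ?m) \<star> (stransp (S m) \<star> H' m)"
      by (simp add: \<omega>_diag star_assoc_colfin)
    also have "\<dots> = S ?m \<star> (L a \<star> R m) \<star> (H m \<star> stransp (R m)) \<star> (stransp (S m) \<star> H' m)"
      by (simp only: *)
    also have "\<dots> = S ?m \<star> (L a \<star> R m) \<star> (H m \<star> ((stransp (R m) \<star> stransp (S m)) \<star> H' m))"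
      by (simp add: star_assoc_colfin)
    also have "stransp (R m) \<star> stransp (S m) = sid"
      by (simp add: R flip: stransp_star)
    finally show ?thesis by (simp add: H')
  qed
  \<comment> \<open>\<open>R m\<close> cancels \<open>S m\<close>, and the remaining
    \<open>L a\<close> is absorbed by \<open>W0_shift\<close>. All factors left of \<open>W0\<close>
    are row-finite.\<close>
  have W1: "shift a (W1 N q S) m = resolvent S H a m \<star> W1 N q S m" for a m
    using W0_shift[OF assms(2)] by (simp add: shift_def W1_def \<omega> star_assoc_rowfin flip: L_def)
  have W2: "shift a (W2 S H) m = resolvent S H a m \<star> W2 S H m" for a m
  proof -
    \<comment> \<open>Here \<open>\<omega>_diag\<close> is the suitable form: every factor after the
      first is column-finite, and \<open>H' m\<close> meets \<open>H m\<close>.\<close>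
    have "resolvent S H a m \<star> W2 S H m = H (m + axis a 1) \<star> (stransp (R (m + axis a 1)) \<star>
        (stransp (S m) \<star> ((H' m \<star> H m) \<star> stransp (R m))))"
      by (simp add: \<omega>_diag W2_def star_assoc_colfin flip: R_def)
    also have "\<dots> = H (m + axis a 1) \<star> (stransp (R (m + axis a 1)) \<star> stransp (R m \<star> S m))"
      by (simp add: H' stransp_star)
    finally show ?thesis by (simp add: R shift_def W2_def flip: R_def)
  qed
  have Lax: "shift b (nJ (N $ a) S) m \<star> resolvent S H b m = resolvent S H b m \<star> nJ (N $ a) S m" for a b m
  proof -
    \<comment> \<open>The inner \<open>R\<close> and \<open>S\<close> at the shifted point cancel;
      the other side has \<open>L b\<close> and \<open>K a\<close> in reverse order.\<close>
    have "shift b (nJ (N $ a) S) m \<star> resolvent S H b m = S (m + axis b 1) \<star> ((K a \<star> L b) \<star> R m)"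
      by (simp add: shift_def J \<omega> star_assoc_rowfin)
    then show ?thesis unfolding comm by (simp add: J \<omega> star_assoc_rowfin)
  qed
  have LaxM: "Mmat S b m \<star> shift b (nJ (N $ a) S) m = nJ (N $ a) S m \<star> Mmat S b m" for a b m
    by (simp add: shift_def J M star_assoc_rowfin)
  \<comment> \<open>Cancellation at the intermediate point leaves an expression symmetric in
    \<open>a\<close> and \<open>b\<close>, up to the order of the two operators and of the two
    shifts.\<close>
  have ZS: "shift a (resolvent S H b) m \<star> resolvent S H a m =
      S (m + axis a 1 + axis b 1) \<star> ((L b \<star> L a) \<star> R m)" for a b m
    by (simp add: shift_def \<omega> star_assoc_rowfin)
  have ZSM: "Mmat S a m \<star> shift a (Mmat S b) m = S m \<star> R (m + axis a 1 + axis b 1)" for a b m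
    by (simp add: shift_def M star_assoc_rowfin)
  have swap: "m + axis a 1 + axis b 1 = m + axis b 1 + axis a 1" for m :: "'d zvec" and a b
    by (simp add: add.assoc add.commute)
  show ?thesis
  proof (intro conjI allI W1 W2 Lax LaxM)
    fix a b m
    show "shift a (resolvent S H b) m \<star> resolvent S H a m =
        shift b (resolvent S H a) m \<star> resolvent S H b m"
      unfolding ZS swap[of m a b] comm(1)[of a b] ..
    show "Mmat S a m \<star> shift a (Mmat S b) m = Mmat S b m \<star> shift b (Mmat S a) m"
      unfolding ZSM swap[of m a b] ..
  qed
qed

end
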